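(* Let $(\overline{\mathbf{R}}_{\mathbf{W}},\overline{\mathbf{W}}_{\mathrm{u}},\overline{\mathbf{W}}_{\mathrm{t}},\overline{q})$ be an optimal solution of the problem obtained from $(\mathcal{P}_{1.3})$ (stated in the context) by dropping the two rank constraints $\mathrm{rank}(\mathbf{W}_{\mathrm{u}})=1$ and $\mathrm{rank}(\mathbf{W}_{\mathrm{t}})=1$. Define $$\widetilde{\mathbf{R}}_{\mathbf{W}}=\overline{\mathbf{R}}_{\mathbf{W}},\qquad \widetilde{\mathbf{W}}_{\mathrm{u}}=\frac{\overline{\mathbf{W}}_{\mathrm{u}}\mathbf{U}\overline{\mathbf{W}}_{\mathrm{u}}^{H}}{\mathrm{Tr}(\mathbf{U}\overline{\mathbf{W}}_{\mathrm{u}})},\qquad \widetilde{\mathbf{W}}_{\mathrm{t}}=\frac{\overline{\mathbf{W}}_{\mathrm{t}}\mathbf{F}\overline{\mathbf{W}}_{\mathrm{t}}^{H}}{\mathrm{Tr}(\mathbf{F}\overline{\mathbf{W}}_{\mathrm{t}})},\qquad \widetilde{q}=\overline{q}.$$ Then $(\widetilde{\mathbf{R}}_{\mathbf{W}},\widetilde{\mathbf{W}}_{\mathrm{u}},\widetilde{\mathbf{W}}_{\mathrm{t}},\widetilde{q})$ is a rank-1 optimal solution of $(\mathcal{P}_{1.3})$, that is, an optimal solution of $(\mathcal{P}_{1.3})$ with the rank constraints included; in particular $\mathrm{rank}(\widetilde{\mathbf{W}}_{\mathrm{u}})=\mathrm{rank}(\widetilde{\mathbf{W}}_{\mathrm{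t}})=1$.
   Context: Notation: $(\cdot)^H$ is the conjugate transpose, $\mathrm{Tr}$ the trace, and $\mathbf{A}\succeq 0$ means that $\mathbf{A}$ is Hermitian positive semidefinite. Data: positive integers $N_t\le N_r$; an angle $\theta_i\in\mathbb{R}$; positive reals $\alpha$ (backscatter modulation efficiency), $P_T$ (power budget), $\gamma_{\mathrm{uth}}$ (SINR threshold of the user), and $\sigma_{\mathrm{t}}^2,\sigma_{\mathrm{ap}}^2,\sigma_{\mathrm{u}}^2$ (noise powers); a complex number $h_{\mathrm{tu}}$ (the tag-to-user channel, taken at its maximal value); a row vector $\mathbf{h}_{\mathrm{u}}\in\mathbb{C}^{1\times N_t}$ (the channel to the user); and the steering row vector $$\mathbf{a}(\theta_i)=\left[1,e^{j\pi\sin\theta_i},e^{2j\pi\sin\theta_i},\ldots,e^{(N_t-1)j\pi\sin\theta_i}\right]\in\mathbb{C}^{1\times N_t},\qquad j^2=-1.$$ The channel to the tag is taken to be $\mathbf{h}_{\mathrm{f}}=\mathbf{a}(\theta_i)$. Put $\mathbf{U}=\mathbf{h}_{\mathrm{u}}^H\mathbf{h}_{\mathrm{u}}$ and $\mathbf{F}=\mathbf{h}_{\mathrm{f}}^H\mathbf{h}_{\mathrm{f}}$, both in $\mathbb{C}^{N_t\times N_t}$. Problem $(\mathcal{P}_{1.3})$: minimize $-q$ over Hermitian $N_t\times N_t$ complex matrices $\mathbf{R}_{\mathbf{W}},\mathbf{W}_{\mathrm{u}},\mathbf{W}_{\mathrm{t}}$ with $\mathbf{W}_{\mathrm{u}}\succeq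 0$, $\mathbf{W}_{\mathrm{t}}\succeq 0$, and $q\in\mathbb{R}$, subject to 1. $\mathrm{Tr}(\mathbf{U}\mathbf{W}_{\mathrm{u}})-\gamma_{\mathrm{uth}}\mathrm{Tr}\left(\mathbf{U}(\mathbf{R}_{\mathbf{W}}-\mathbf{W}_{\mathrm{u}})\right)-\gamma_{\mathrm{uth}}\alpha|h_{\mathrm{tu}}|^2\mathrm{Tr}(\mathbf{F}\mathbf{R}_{\mathbf{W}})-\gamma_{\mathrm{uth}}\alpha|h_{\mathrm{tu}}|^2\sigma_{\mathrm{t}}^2-\gamma_{\mathrm{uth}}\sigma_{\mathrm{u}}^2\ge 0$; 2. $\alpha N_r\,\mathbf{a}(\theta_i)\mathbf{R}_{\mathbf{W}}\mathbf{a}(\theta_i)^H-q\alpha N_r\sigma_{\mathrm{t}}^2-q\sigma_{\mathrm{ap}}^2\ge 0$; 3. $\mathrm{Tr}(\mathbf{R}_{\mathbf{W}})\le P_T$; 4. $q\ge 0$; 5. $\mathbf{R}_{\mathbf{W}}-\mathbf{W}_{\mathrm{u}}-\mathbf{W}_{\mathrm{t}}\succeq 0$; 6. $\mathrm{rank}(\mathbf{W}_{\mathrm{u}})=1$; 7. $\mathrm{rank}(\mathbf{W}_{\mathrm{t}})=1$. The relaxed problem (without rank constraints) keeps constraints 1–5 together with $\mathbf{W}_{\mathrm{u}}\succeq0$ and $\mathbf{W}_{\mathrm{t}}\succeq 0$.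
   Formalization: The formal statement additionally assumes that Tr(F W̄_t) is nonzero; without it W̃_t is undefined, for example at relaxed optimal solutions with W̄_t = 0, which exist whenever a relaxed optimal solution exists. *)

theory Defs
  imports "Jordan_Normal_Form.Schur_Decomposition" "Jordan_Normal_Form.DL_Rank"
begin

definition mat_trace :: "complex mat \<Rightarrow> complex" where
  "mat_trace A = (\<Sum>i<dim_row A. A $$ (i, i))"

definition hermitian_mat :: "nat \<Rightarrow> complex mat \<Rightarrow> bool" where
  "hermitian_mat n A \<longleftrightarrow> A \<in> carrier_mat n n \<and> mat_adjoint A = A"

text \<open>The quadratic form of a Hermitian matrix is real, so taking its real part loses nothing.\<close>

definition psd_mat :: "nat \<Rightarrow> complex mat \<Rightarrow> bool" where
  "psd_mat n A \<longleftrightarrow>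
     hermitian_mat n A \<and> (\<forall>v \<in> carrier_vec n. 0 \<le> Re ((A *\<^sub>v v) \<bullet>c v))"

text \<open>Row vectors are matrices with a single row.\<close>

definition steering :: "nat \<Rightarrow> real \<Rightarrow> complex mat" where
  "steering n \<theta> = mat 1 n (\<lambda>(_, k). exp (of_nat k * \<i> * complex_of_real (pi * sin \<theta>)))"

text \<open>The noise fields are the noise powers, i.e. the values \<open>\<sigma>\<^sup>2\<close>, not their square roots.\<close>

record backscatter_system =
  num_tx :: nat
  num_rx :: nat
  angle :: real
  modulation_eff :: real
  power_budget :: real
  sinr_threshold :: real
  noise_tag :: real
  noise_ap :: real
  noise_user :: real
  tag_user_channel :: complex
  user_channel :: "complex mat"

definition tag_channel :: "backscatter_system \<Rightarrow> complex mat" where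
  "tag_channel S = steering (num_tx S) (angle S)"

definition user_gram :: "backscatter_system \<Rightarrow> complex mat" where
  "user_gram S = mat_adjoint (user_channel S) * user_channel S"

definition tag_gram :: "backscatter_system \<Rightarrow> complex mat" where
  "tag_gram S = mat_adjoint (tag_channel S) * tag_channel S"

type_synonym design = "complex mat \<times> complex mat \<times> complex mat \<times> real"

text \<open>
  A design is a tuple \<open>(R\<^sub>W, W\<^sub>u, W\<^sub>t, q)\<close>. For Hermitian matrices all traces below, and the
  single entry of \<open>a R\<^sub>W a\<^sup>H\<close>, are real; \<open>Re\<close> only converts them to type \<open>real\<close>.
\<close>

definition relaxed_feasible :: "backscatter_system \<Rightarrow> design \<Rightarrow> bool" where
  "relaxed_feasible S = (\<lambda>(RW, Wu, Wt, q).
     let n = num_tx S; N = real (num_rx S); U = user_gram S; F = tag_gram S;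
         a = steering n (angle S); \<alpha> = modulation_eff S; \<gamma> = sinr_threshold S;
         g = (cmod (tag_user_channel S))\<^sup>2
     in hermitian_mat n RW \<and> psd_mat n Wu \<and> psd_mat n Wt \<and>
        Re (mat_trace (U * Wu)) - \<gamma> * Re (mat_trace (U * (RW - Wu)))
          - \<gamma> * \<alpha> * g * Re (mat_trace (F * RW))
          - \<gamma> * \<alpha> * g * noise_tag S - \<gamma> * noise_user S \<ge> 0 \<and>
        \<alpha> * N * Re ((a * RW * mat_adjoint a) $$ (0, 0))
          - q * \<alpha> * N * noise_tag S - q * noise_ap S \<ge> 0 \<and>
        Re (mat_trace RW) \<le> power_budget S \<and>
        q \<ge> 0 \<and>
        psd_mat n (RW - Wu - Wt))"

definition rank_feasible :: "backscatter_system \<Rightarrow> design \<Rightarrow> bool" where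
  "rank_feasible S = (\<lambda>(RW, Wu, Wt, q).
     relaxed_feasible S (RW, Wu, Wt, q) \<and>
     vec_space.rank (num_tx S) Wu = 1 \<and> vec_space.rank (num_tx S) Wt = 1)"

definition objective :: "design \<Rightarrow> real" where
  "objective = (\<lambda>(RW, Wu, Wt, q). - q)"

definition rank_reduction :: "complex mat \<Rightarrow> complex mat \<Rightarrow> complex mat" where
  "rank_reduction G W = (1 / mat_trace (G * W)) \<cdot>\<^sub>m (W * G * mat_adjoint W)"

end

theory Submission
  imports Defs
begin

text \<open>
  Both Gram matrices have the form \<open>v v\<^sup>H\<close>, so the reduction of \<open>W\<close> is
  \<open>(W v) (W v)\<^sup>H / (v\<^sup>H W v)\<close>. It has the same trace against \<open>v v\<^sup>H\<close> as \<open>W\<close>, and the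
  Cauchy--Schwarz inequality for the semidefinite form of \<open>W\<close> says precisely that it lies below
  \<open>W\<close> in the semidefinite order. Hence replacing \<open>W\<^sub>u\<close> and \<open>W\<^sub>t\<close> by their reductions preserves
  all constraints and the objective. The denominator for \<open>W\<^sub>u\<close> is nonzero because the user noise
  power is positive; nothing in the problem forces the one for \<open>W\<^sub>t\<close> to be nonzero.
\<close>

section \<open>Adjoints and Hermitian matrices, entry by entry\<close>

lemma mat_adjoint_carrier:
  assumes "A \<in> carrier_mat m n"
  shows "mat_adjoint A \<in> carrier_mat n m"
  using assms unfolding mat_adjoint_def by auto

lemma mat_adjoint_index:
  fixes A :: "complex mat"
  assumes "A \<in> carrier_mat m n" "i < n" "j < m"
  shows "mat_adjoint A $$ (i, j) = cnj (A $$ (j, i))"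
  using assms unfolding mat_adjoint_def by (simp add: mat_of_rows_index)

lemma hermitian_mat_carrier: "hermitian_mat n A \<Longrightarrow> A \<in> carrier_mat n n"
  by (simp add: hermitian_mat_def)

lemma psd_mat_hermitian: "psd_mat n A \<Longrightarrow> hermitian_mat n A"
  by (simp add: psd_mat_def)

lemma psd_mat_carrier: "psd_mat n A \<Longrightarrow> A \<in> carrier_mat n n"
  by (simp add: psd_mat_def hermitian_mat_def)

text \<open>The entrywise form reduces closure under sums, differences and real multiples to
  conjugation of complex numbers.\<close>

lemma hermitian_mat_iff:
  "hermitian_mat n A \<longleftrightarrow>
     A \<in> carrier_mat n n \<and> (\<forall>i<n. \<forall>j<n. cnj (A $$ (j, i)) = A $$ (i, j))"
proof (cases "A \<in> carrier_mat n n")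
  case True
  note c = mat_adjoint_carrier[OF True]
  have "mat_adjoint A = A \<longleftrightarrow> (\<forall>i<n. \<forall>j<n. cnj (A $$ (j, i)) = A $$ (i, j))"
  proof
    assume "mat_adjoint A = A"
    then show "\<forall>i<n. \<forall>j<n. cnj (A $$ (j, i)) = A $$ (i, j)"
      using mat_adjoint_index[OF True] by metis
  next
    assume h: "\<forall>i<n. \<forall>j<n. cnj (A $$ (j, i)) = A $$ (i, j)"
    show "mat_adjoint A = A"
      by (rule eq_matI) (use True c h mat_adjoint_index[OF True] in auto)
  qed
  with True show ?thesis by (simp add: hermitian_mat_def)
qed (simp add: hermitian_mat_def)

lemma hermitian_mat_add:
  "hermitian_mat n A \<Longrightarrow> hermitian_mat n B \<Longrightarrow> hermitian_mat n (A + B)"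
  unfolding hermitian_mat_iff by auto

lemma hermitian_mat_minus:
  "hermitian_mat n A \<Longrightarrow> hermitian_mat n B \<Longrightarrow> hermitian_mat n (A - B)"
  unfolding hermitian_mat_iff by (auto intro!: minus_carrier_mat)

section \<open>Sesquilinear forms as double sums\<close>

lemma cscalar_prod_sum:
  fixes x y :: "complex vec"
  assumes "x \<in> carrier_vec n" "y \<in> carrier_vec n"
  shows "x \<bullet>c y = (\<Sum>i<n. x $ i * cnj (y $ i))"
  using assms by (simp add: scalar_prod_def lessThan_atLeast0)

lemma mult_mat_vec_sum:
  assumes "A \<in> carrier_mat n n" "x \<in> carrier_vec n" "i < n"
  shows "(A *\<^sub>v x) $ i = (\<Sum>j<n. A $$ (i, j) * x $ j)"
  using assms by (simp add: scalar_prod_def lessThan_atLeast0)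

lemma cscalar_prod_swap:
  fixes x y :: "complex vec"
  assumes "x \<in> carrier_vec n" "y \<in> carrier_vec n"
  shows "x \<bullet>c y = cnj (y \<bullet>c x)"
  by (simp add: cscalar_prod_sum[OF assms] cscalar_prod_sum[OF assms(2,1)] mult.commute)

text \<open>A common normal form: additivity in the matrix and expansion in the vectors become
  identities between finite sums.\<close>

lemma sesquilinear_sum:
  fixes A :: "complex mat"
  assumes A: "A \<in> carrier_mat n n" and x: "x \<in> carrier_vec n" and y: "y \<in> carrier_vec n"
  shows "(A *\<^sub>v x) \<bullet>c y = (\<Sum>i<n. \<Sum>j<n. A $$ (i, j) * x $ j * cnj (y $ i))"
proof -
  have "(A *\<^sub>v x) \<bullet>c y = (\<Sum>i<n. (A *\<^sub>v x) $ i * cnj (y $ i))"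
    using A x y by (intro cscalar_prod_sum) auto
  also have "\<dots> = (\<Sum>i<n. \<Sum>j<n. A $$ (i, j) * x $ j * cnj (y $ i))"
    by (rule sum.cong[OF refl])
       (simp add: mult_mat_vec_sum[OF A x] sum_distrib_right del: index_mult_mat_vec)
  finally show ?thesis .
qed

text \<open>Conjugating the double sum turns each entry into its mirror image; exchanging the order
  of summation does the rest.\<close>

lemma hermitian_cscalar_prod_swap:
  assumes H: "hermitian_mat n A" and x: "x \<in> carrier_vec n" and y: "y \<in> carrier_vec n"
  shows "(A *\<^sub>v y) \<bullet>c x = cnj ((A *\<^sub>v x) \<bullet>c y)"
proof -
  note A = hermitian_mat_carrier[OF H]
  have h: "cnj (A $$ (i, j)) = A $$ (j, i)" if "i < n" "j < n" for i j
    using H that unfolding hermitian_mat_iff by auto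
  have "(A *\<^sub>v y) \<bullet>c x = (\<Sum>j<n. \<Sum>i<n. A $$ (j, i) * y $ i * cnj (x $ j))"
    by (rule sesquilinear_sum[OF A y x])
  also have "\<dots> = (\<Sum>i<n. \<Sum>j<n. A $$ (j, i) * y $ i * cnj (x $ j))"
    by (rule sum.swap)
  also have "\<dots> = cnj ((A *\<^sub>v x) \<bullet>c y)"
    unfolding sesquilinear_sum[OF A x y] cnj_sum
    by (intro sum.cong refl) (simp add: h)
  finally show ?thesis .
qed

lemma hermitian_quadratic_form_real:
  assumes "hermitian_mat n A" and "x \<in> carrier_vec n"
  shows "complex_of_real (Re ((A *\<^sub>v x) \<bullet>c x)) = (A *\<^sub>v x) \<bullet>c x"
  using hermitian_cscalar_prod_swap[OF assms(1) assms(2) assms(2)]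
  by (metis Reals_cnj_iff of_real_Re)

lemma sesquilinear_add:
  fixes A B :: "complex mat"
  assumes "A \<in> carrier_mat n n" "B \<in> carrier_mat n n" "x \<in> carrier_vec n" "y \<in> carrier_vec n"
  shows "((A + B) *\<^sub>v x) \<bullet>c y = (A *\<^sub>v x) \<bullet>c y + (B *\<^sub>v x) \<bullet>c y"
  using assms
  by (simp add: sesquilinear_sum[of _ n] sum.distrib algebra_simps del: add_mult_distrib_mat_vec)

lemma sesquilinear_minus:
  fixes A B :: "complex mat"
  assumes "A \<in> carrier_mat n n" "B \<in> carrier_mat n n" "x \<in> carrier_vec n" "y \<in> carrier_vec n"
  shows "((A - B) *\<^sub>v x) \<bullet>c y = (A *\<^sub>v x) \<bullet>c y - (B *\<^sub>v x) \<bullet>c y"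
  using assms
  by (simp add: sesquilinear_sum[of _ n] minus_carrier_mat sum_subtractf algebra_simps
      del: minus_mult_distrib_mat_vec)

section \<open>Semidefinite forms and the Cauchy-Schwarz inequality\<close>

lemma psd_mat_add:
  assumes "psd_mat n A" "psd_mat n B"
  shows "psd_mat n (A + B)"
  using assms
  by (auto simp: psd_mat_def hermitian_mat_add sesquilinear_add[OF psd_mat_carrier psd_mat_carrier, OF assms])

lemma quadratic_form_add_smult:
  fixes A :: "complex mat"
  assumes A: "A \<in> carrier_mat n n" and x: "x \<in> carrier_vec n" and v: "v \<in> carrier_vec n"
  shows "(A *\<^sub>v (x + k \<cdot>\<^sub>v v)) \<bullet>c (x + k \<cdot>\<^sub>v v)
    = (A *\<^sub>v x) \<bullet>c x + k * ((A *\<^sub>v v) \<bullet>c x) + cnj k * ((A *\<^sub>v x) \<bullet>c v)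
      + k * cnj k * ((A *\<^sub>v v) \<bullet>c v)"
  using assms
  by (simp add: sesquilinear_sum[of _ n] sum.distrib sum_distrib_left algebra_simps
      del: mult_add_distrib_mat_vec)

text \<open>Along the line \<open>x + k v\<close> the form is a nonnegative quadratic in
  \<open>k\<close>; its minimal value gives the bound. Positivity at \<open>v\<close> makes the
  minimiser well defined.\<close>

lemma psd_cauchy_schwarz:
  assumes P: "psd_mat n A" and v: "v \<in> carrier_vec n" and x: "x \<in> carrier_vec n"
    and pos: "0 < Re ((A *\<^sub>v v) \<bullet>c v)"
  shows "(cmod ((A *\<^sub>v v) \<bullet>c x))\<^sup>2 \<le> Re ((A *\<^sub>v v) \<bullet>c v) * Re ((A *\<^sub>v x) \<bullet>c x)"
proof -
  note H = psd_mat_hermitian[OF P] and A = psd_mat_carrier[OF P]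
  define c where "c = Re ((A *\<^sub>v v) \<bullet>c v)"
  define b where "b = (A *\<^sub>v v) \<bullet>c x"
  \<comment> \<open>the minimiser of the quadratic form along \<open>x + k v\<close>\<close>
  define k where "k = - cnj b / complex_of_real c"
  have c: "(A *\<^sub>v v) \<bullet>c v = complex_of_real c"
    unfolding c_def using hermitian_quadratic_form_real[OF H v] by simp
  have b: "(A *\<^sub>v x) \<bullet>c v = cnj b"
    unfolding b_def by (rule hermitian_cscalar_prod_swap[OF H v x])
  have c0: "c > 0" using pos c_def by simp
  \<comment> \<open>Each cross term equals \<open>-|b|^2/c\<close> and the square term equals
    \<open>+|b|^2/c\<close>.\<close>
  have e: "k * b + cnj k * cnj b + k * cnj k * complex_of_real c
      = - complex_of_real ((cmod b)\<^sup>2 / c)"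
    using c0
    by (simp add: k_def field_simps complex_norm_square del: of_real_power)
  have "0 \<le> Re ((A *\<^sub>v (x + k \<cdot>\<^sub>v v)) \<bullet>c (x + k \<cdot>\<^sub>v v))"
    using P v x by (simp add: psd_mat_def)
  also have "(A *\<^sub>v (x + k \<cdot>\<^sub>v v)) \<bullet>c (x + k \<cdot>\<^sub>v v)
      = (A *\<^sub>v x) \<bullet>c x + (k * b + cnj k * cnj b + k * cnj k * complex_of_real c)"
    unfolding quadratic_form_add_smult[OF A x v] b c b_def[symmetric] by (simp add: algebra_simps)
  finally have "(cmod b)\<^sup>2 / c \<le> Re ((A *\<^sub>v x) \<bullet>c x)"
    unfolding e by simp
  then show ?thesis
    using c0 unfolding b_def[symmetric] c_def[symmetric] by (simp add: field_simps)
qed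

section \<open>Rank-one matrices \<open>u u^H\<close>\<close>

definition outer :: "complex vec \<Rightarrow> complex mat" where
  "outer u = mat (dim_vec u) (dim_vec u) (\<lambda>(i, j). u $ i * cnj (u $ j))"

lemma outer_carrier: "u \<in> carrier_vec n \<Longrightarrow> outer u \<in> carrier_mat n n"
  by (simp add: outer_def)

lemma outer_index: "u \<in> carrier_vec n \<Longrightarrow> i < n \<Longrightarrow> j < n \<Longrightarrow> outer u $$ (i, j) = u $ i * cnj (u $ j)"
  by (simp add: outer_def)

text \<open>Since \<open>h\<close> is a row, the column \<open>v\<close> with
  \<open>h^H h = v v^H\<close> is \<open>h^H\<close>, whose entries are conjugated.\<close>

lemma adjoint_mult_row:
  fixes h :: "complex mat"
  assumes h: "h \<in> carrier_mat 1 n"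
  shows "mat_adjoint h * h = outer (conjugate (row h 0))"
proof (rule eq_matI)
  note ah = mat_adjoint_carrier[OF h]
  fix i j assume "i < dim_row (outer (conjugate (row h 0)))" "j < dim_col (outer (conjugate (row h 0)))"
  then have ij: "i < n" "j < n" using h by (auto simp: outer_def)
  show "(mat_adjoint h * h) $$ (i, j) = outer (conjugate (row h 0)) $$ (i, j)"
    using ij h ah mat_adjoint_index[OF h ij(1), of 0]
    by (simp add: outer_def scalar_prod_def)
qed (use h mat_adjoint_carrier[OF h] in \<open>auto simp: outer_def\<close>)

text \<open>The entries of \<open>v v^H\<close> are products, so the two inner summations separate
  into an entry of \<open>W v\<close> and a conjugated one.\<close>

lemma mult_outer_mult_adjoint:
  assumes W: "W \<in> carrier_mat n n" and v: "v \<in> carrier_vec n"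
  shows "W * outer v * mat_adjoint W = outer (W *\<^sub>v v)"
proof (rule eq_matI)
  note aW = mat_adjoint_carrier[OF W] and O = outer_carrier[OF v]
  fix i j assume "i < dim_row (outer (W *\<^sub>v v))" "j < dim_col (outer (W *\<^sub>v v))"
  then have ij: "i < n" "j < n" using W by (auto simp: outer_def)
  have WO: "(W * outer v) $$ (i, l) = (W *\<^sub>v v) $ i * cnj (v $ l)" if "l < n" for l
  proof -
    have "(W * outer v) $$ (i, l) = (\<Sum>k<n. W $$ (i, k) * (v $ k * cnj (v $ l)))"
      using W O v ij that by (simp add: scalar_prod_def lessThan_atLeast0 outer_index)
    then show ?thesis
      by (simp add: mult_mat_vec_sum[OF W v ij(1)] sum_distrib_right mult.assoc del: index_mult_mat_vec)
  qed
  have "(W * outer v * mat_adjoint W) $$ (i, j)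
      = (\<Sum>l<n. (W * outer v) $$ (i, l) * mat_adjoint W $$ (l, j))"
    using W O aW ij by (simp add: scalar_prod_def lessThan_atLeast0 del: assoc_mult_mat)
  also have "\<dots> = (W *\<^sub>v v) $ i * (\<Sum>l<n. cnj (W $$ (j, l) * v $ l))"
    by (simp add: WO mat_adjoint_index[OF W _ ij(2)] sum_distrib_left algebra_simps
        del: index_mult_mat_vec)
  also have "\<dots> = (W *\<^sub>v v) $ i * cnj ((W *\<^sub>v v) $ j)"
    by (simp add: mult_mat_vec_sum[OF W v ij(2)] del: index_mult_mat_vec)
  also have "\<dots> = outer (W *\<^sub>v v) $$ (i, j)"
    using W v ij by (simp add: outer_def)
  finally show "(W * outer v * mat_adjoint W) $$ (i, j) = outer (W *\<^sub>v v) $$ (i, j)" .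
qed (use W mat_adjoint_carrier[OF W] in \<open>auto simp: outer_def\<close>)

text \<open>Cyclicity of the trace, \<open>Tr(u u^H A) = u^H A u\<close>; it turns the traces of the
  constraints into values of quadratic forms.\<close>

lemma trace_outer_mult:
  assumes A: "A \<in> carrier_mat n n" and u: "u \<in> carrier_vec n"
  shows "mat_trace (outer u * A) = (A *\<^sub>v u) \<bullet>c u"
proof -
  have "mat_trace (outer u * A) = (\<Sum>i<n. \<Sum>j<n. A $$ (j, i) * u $ i * cnj (u $ j))"
    using A u outer_carrier[OF u]
    by (simp add: mat_trace_def scalar_prod_def lessThan_atLeast0 outer_index algebra_simps)
  also have "\<dots> = (A *\<^sub>v u) \<bullet>c u"
    unfolding sesquilinear_sum[OF A u u] by (rule sum.swap)
  finally show ?thesis .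
qed

lemma smult_outer_sesquilinear:
  assumes u: "u \<in> carrier_vec n" and x: "x \<in> carrier_vec n" and y: "y \<in> carrier_vec n"
  shows "((c \<cdot>\<^sub>m outer u) *\<^sub>v x) \<bullet>c y = c * (x \<bullet>c u) * (u \<bullet>c y)"
proof -
  have "((c \<cdot>\<^sub>m outer u) *\<^sub>v x) \<bullet>c y = (\<Sum>i<n. \<Sum>j<n. c * (x $ j * cnj (u $ j)) * (u $ i * cnj (y $ i)))"
    using outer_carrier[OF u]
    by (subst sesquilinear_sum[of _ n])
       (auto simp: x y outer_index[OF u] algebra_simps intro!: sum.cong)
  also have "\<dots> = c * (x \<bullet>c u) * (u \<bullet>c y)"
    by (simp add: cscalar_prod_sum[OF x u] cscalar_prod_sum[OF u y] sum_distrib_left sum_distrib_right)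
  finally show ?thesis .
qed

text \<open>Entries of product form bound the rank above by 1; a nonzero column bounds it
  below.\<close>

lemma rank_smult_outer:
  assumes u: "u \<in> carrier_vec n" and u0: "u \<noteq> 0\<^sub>v n" and c: "c \<noteq> 0"
  shows "vec_space.rank n (c \<cdot>\<^sub>m outer u) = 1"
proof -
  interpret vec_space "TYPE(complex)" n .
  let ?A = "c \<cdot>\<^sub>m outer u"
  have A: "?A \<in> carrier_mat n n" using outer_carrier[OF u] by simp
  have le: "rank ?A \<le> 1"
    by (rule rank_le_1_product_entries[OF A, of "\<lambda>i. c * u $ i" "\<lambda>j. cnj (u $ j)"])
       (use u in \<open>auto simp: outer_def\<close>)
  obtain j where j: "j < n" "u $ j \<noteq> 0"
    using u u0 by (metis eq_vecI carrier_vecD index_zero_vec(1) index_zero_vec(2))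
  \<comment> \<open>This column is \<open>c * cnj (u $ j)\<close> times \<open>u\<close>, so its
    entry at \<open>j\<close> is \<open>c |u_j|^2\<close>, which is nonzero.\<close>
  let ?w = "col ?A j"
  have w: "?w \<in> carrier_vec n" using A j by auto
  have "?w $ j \<noteq> 0" using u j c by (simp add: outer_def)
  then have w0: "?w \<noteq> 0\<^sub>v n" using j by auto
  \<comment> \<open>Dependence of the singleton would put \<open>?w\<close> in the span of the empty
    set, which is zero.\<close>
  have "lin_indpt {?w}"
    using lin_dep_iff_in_span[of "{}" ?w] w w0 by (simp add: span_empty lin_dep_def)
  then have "card {?w} \<le> rank ?A"
    using A j by (intro rank_ge_card_indpt[OF A]) (auto simp: cols_def)
  with le show ?thesis by simp
qed

section \<open>The reduction of a semidefinite matrix\<close>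

lemma rank_reduction_outer:
  assumes W: "W \<in> carrier_mat n n" and v: "v \<in> carrier_vec n"
  shows "rank_reduction (outer v) W = (1 / ((W *\<^sub>v v) \<bullet>c v)) \<cdot>\<^sub>m outer (W *\<^sub>v v)"
  by (simp add: rank_reduction_def trace_outer_mult[OF W v] mult_outer_mult_adjoint[OF W v])

text \<open>With \<open>u = W v\<close> and \<open>c = v^H W v > 0\<close>, the reduction is
  \<open>u u^H / c\<close> and its form at \<open>x\<close> is \<open>|x^H u|^2 / c\<close>. The two
  semidefiniteness claims and the trace identity are read off from this formula.\<close>

lemma rank_reduction_properties:
  assumes P: "psd_mat n W" and v: "v \<in> carrier_vec n"
    and nz: "mat_trace (outer v * W) \<noteq> 0"
  shows "psd_mat n (rank_reduction (outer v) W)"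
    and "psd_mat n (W - rank_reduction (outer v) W)"
    and "mat_trace (outer v * rank_reduction (outer v) W) = mat_trace (outer v * W)"
    and "vec_space.rank n (rank_reduction (outer v) W) = 1"
proof -
  note H = psd_mat_hermitian[OF P] and W = psd_mat_carrier[OF P]
  define c where "c = Re ((W *\<^sub>v v) \<bullet>c v)"
  let ?u = "W *\<^sub>v v" and ?X = "rank_reduction (outer v) W"
  have u: "?u \<in> carrier_vec n" using W v by simp
  have c: "?u \<bullet>c v = complex_of_real c"
    unfolding c_def using hermitian_quadratic_form_real[OF H v] by simp
  have "c \<noteq> 0" using nz by (simp add: trace_outer_mult[OF W v] c)
  moreover have "c \<ge> 0" using P v by (simp add: c_def psd_mat_def)
  ultimately have c0: "c > 0" by simp
  have X: "?X = (1 / complex_of_real c) \<cdot>\<^sub>m outer ?u"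
    by (simp add: rank_reduction_outer[OF W v] c)
  have Xc: "?X \<in> carrier_mat n n" using outer_carrier[OF u] by (simp add: X)
  have HX: "hermitian_mat n ?X"
    using outer_carrier[OF u] unfolding hermitian_mat_iff X by (auto simp: outer_index[OF u])
  \<comment> \<open>Swapping \<open>x \<bullet>c ?u\<close> makes the two factors conjugate, so
    their product is a squared modulus.\<close>
  have form: "(?X *\<^sub>v x) \<bullet>c x = complex_of_real ((cmod (?u \<bullet>c x))\<^sup>2 / c)" if x: "x \<in> carrier_vec n" for x
    unfolding X smult_outer_sesquilinear[OF u x x] cscalar_prod_swap[OF x u]
    by (simp add: complex_norm_square mult.commute del: of_real_power)
  show "psd_mat n ?X"
    using HX c0 by (simp add: psd_mat_def form)
  show "psd_mat n (W - ?X)"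
    unfolding psd_mat_def
  proof (intro conjI ballI)
    show "hermitian_mat n (W - ?X)" by (rule hermitian_mat_minus[OF H HX])
    fix x :: "complex vec" assume x: "x \<in> carrier_vec n"
    have "(cmod (?u \<bullet>c x))\<^sup>2 / c \<le> Re ((W *\<^sub>v x) \<bullet>c x)"
      using psd_cauchy_schwarz[OF P v x] c0 by (simp add: c_def field_simps)
    then show "0 \<le> Re (((W - ?X) *\<^sub>v x) \<bullet>c x)"
      by (simp add: sesquilinear_minus[OF W Xc x x] form[OF x])
  qed
  \<comment> \<open>At \<open>x = v\<close> the formula gives \<open>c^2 / c = c\<close>.\<close>
  show "mat_trace (outer v * ?X) = mat_trace (outer v * W)"
    using c0 by (simp add: trace_outer_mult[OF W v] trace_outer_mult[OF Xc v] form[OF v] c power2_eq_square)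
  \<comment> \<open>A zero \<open>?u\<close> would force
    \<open>c = ?u \<bullet>c v = 0\<close>.\<close>
  have "?u \<noteq> 0\<^sub>v n" using c c0 v by auto
  then show "vec_space.rank n ?X = 1"
    unfolding X using c0 by (intro rank_smult_outer[OF u]) auto
qed

section \<open>From the relaxed optimum to the rank-one optimum\<close>

theorem proposition1:
  fixes S :: backscatter_system
    and RW Wu Wt :: "complex mat" and q :: real
  assumes "0 < num_tx S" and "num_tx S \<le> num_rx S"
    and "0 < modulation_eff S" and "0 < power_budget S" and "0 < sinr_threshold S"
    and "0 < noise_tag S" and "0 < noise_ap S" and "0 < noise_user S"
    and "user_channel S \<in> carrier_mat 1 (num_tx S)"
    and "is_arg_min objective (relaxed_feasible S) (RW, Wu, Wt, q)"
    and "mat_trace (tag_gram S * Wt) \<noteq> 0"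
  shows "is_arg_min objective (rank_feasible S)
           (RW, rank_reduction (user_gram S) Wu, rank_reduction (tag_gram S) Wt, q)
       \<and> vec_space.rank (num_tx S) (rank_reduction (user_gram S) Wu) = 1
       \<and> vec_space.rank (num_tx S) (rank_reduction (tag_gram S) Wt) = 1"
proof -
  define n where "n = num_tx S"
  define g where "g = (cmod (tag_user_channel S))\<^sup>2"
  define v where "v = conjugate (row (user_channel S) 0)"
  define f where "f = conjugate (row (tag_channel S) 0)"
  let ?\<gamma> = "sinr_threshold S" and ?\<alpha> = "modulation_eff S"
  have hu: "user_channel S \<in> carrier_mat 1 n" using assms(9) by (simp add: n_def)
  have hf: "tag_channel S \<in> carrier_mat 1 n" by (simp add: tag_channel_def steering_def n_def)
  have v: "v \<in> carrier_vec n" unfolding v_def carrier_vec_def using hu by simp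
  have f: "f \<in> carrier_vec n" unfolding f_def carrier_vec_def using hf by simp
  have U: "user_gram S = outer v" unfolding user_gram_def v_def by (rule adjoint_mult_row[OF hu])
  have F: "tag_gram S = outer f" unfolding tag_gram_def f_def by (rule adjoint_mult_row[OF hf])
  have feas: "relaxed_feasible S (RW, Wu, Wt, q)"
    and opt: "\<And>d. relaxed_feasible S d \<Longrightarrow> \<not> objective d < - q"
    using assms(10) by (auto simp: is_arg_min_def objective_def)
  have HR: "hermitian_mat n RW" and Pu: "psd_mat n Wu" and Pt: "psd_mat n Wt"
    and sinr: "Re (mat_trace (outer v * Wu)) - ?\<gamma> * Re (mat_trace (outer v * (RW - Wu)))
          - ?\<gamma> * ?\<alpha> * g * Re (mat_trace (outer f * RW))
          - ?\<gamma> * ?\<alpha> * g * noise_tag S - ?\<gamma> * noise_user S \<ge> 0"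
    and slack: "psd_mat n (RW - Wu - Wt)"
    using feas by (simp_all add: relaxed_feasible_def Let_def n_def g_def U F)
  note R = hermitian_mat_carrier[OF HR] and Wu = psd_mat_carrier[OF Pu] and Wt = psd_mat_carrier[OF Pt]
  \<comment> \<open>Splits the interference so that it depends on \<open>W\<close> only through the
    trace that the reduction preserves.\<close>
  have trace_minus: "mat_trace (outer v * (RW - W)) = (RW *\<^sub>v v) \<bullet>c v - mat_trace (outer v * W)"
    if W: "W \<in> carrier_mat n n" for W
    using R W v by (simp add: trace_outer_mult[of _ n] minus_carrier_mat sesquilinear_minus)
  \<comment> \<open>Feasibility states only that \<open>RW\<close> is Hermitian; it is semidefinite
    as the slack plus two semidefinite matrices. This makes the interference terms
    nonnegative.\<close>
  have "psd_mat n (RW - Wu - Wt + Wu + Wt)"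
    by (intro psd_mat_add slack Pu Pt)
  also have "RW - Wu - Wt + Wu + Wt = RW"
    using R Wu Wt by (intro eq_matI) auto
  finally have PR: "psd_mat n RW" .
  have Rv: "0 \<le> Re ((RW *\<^sub>v v) \<bullet>c v)" and Rf: "0 \<le> Re (mat_trace (outer f * RW))"
    using PR v f by (auto simp: psd_mat_def trace_outer_mult[OF R f])
  \<comment> \<open>Without useful signal the SINR constraint would bound a sum of nonnegative
    terms, including the positive user noise term, by zero.\<close>
  have nzu: "mat_trace (outer v * Wu) \<noteq> 0"
  proof
    assume "mat_trace (outer v * Wu) = 0"
    then have "?\<gamma> * Re ((RW *\<^sub>v v) \<bullet>c v) + ?\<gamma> * ?\<alpha> * g * Re (mat_trace (outer f * RW))
          + ?\<gamma> * ?\<alpha> * g * noise_tag S + ?\<gamma> * noise_user S \<le> 0"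
      using sinr by (simp add: trace_minus[OF Wu])
    moreover have "0 \<le> ?\<gamma> * Re ((RW *\<^sub>v v) \<bullet>c v)" "0 < ?\<gamma> * noise_user S"
      "0 \<le> ?\<gamma> * ?\<alpha> * g * Re (mat_trace (outer f * RW))" "0 \<le> ?\<gamma> * ?\<alpha> * g * noise_tag S"
      using assms Rv Rf by (simp_all add: g_def)
    ultimately show False by linarith
  qed
  let ?Xu = "rank_reduction (outer v) Wu" and ?Xt = "rank_reduction (outer f) Wt"
  have nzt: "mat_trace (outer f * Wt) \<noteq> 0" using assms(11) by (simp add: F)
  note u = rank_reduction_properties[OF Pu v nzu]
    and t = rank_reduction_properties[OF Pt f nzt]
  note Xu = psd_mat_carrier[OF u(1)] and Xt = psd_mat_carrier[OF t(1)]
  \<comment> \<open>The new slack is the old one plus what each reduction removes, and both of these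
    residuals are semidefinite.\<close>
  have "psd_mat n (RW - Wu - Wt + (Wu - ?Xu) + (Wt - ?Xt))"
    by (intro psd_mat_add slack u t)
  also have "RW - Wu - Wt + (Wu - ?Xu) + (Wt - ?Xt) = RW - ?Xu - ?Xt"
    using R Wu Wt Xu Xt by (intro eq_matI) auto
  finally have slack': "psd_mat n (RW - ?Xu - ?Xt)" .
  \<comment> \<open>With \<open>u(3)\<close> this leaves the left side of the SINR constraint
    unchanged; power and sensing involve only \<open>RW\<close> and \<open>q\<close>.\<close>
  have "mat_trace (outer v * (RW - ?Xu)) = mat_trace (outer v * (RW - Wu))"
    by (simp add: trace_minus[OF Xu] trace_minus[OF Wu] u(3))
  then have "relaxed_feasible S (RW, ?Xu, ?Xt, q)"
    using feas u(1,3) t(1) slack'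
    by (simp add: relaxed_feasible_def Let_def U F flip: n_def)
  then have "rank_feasible S (RW, ?Xu, ?Xt, q)"
    using u(4) t(4) by (simp add: rank_feasible_def flip: n_def)
  \<comment> \<open>The rank constraints only shrink the feasible set, so the relaxed optimum bounds
    every competitor; it is attained since \<open>q\<close> is unchanged.\<close>
  moreover have "relaxed_feasible S d" if "rank_feasible S d" for d
    using that by (cases d) (simp add: rank_feasible_def)
  ultimately have "is_arg_min objective (rank_feasible S) (RW, ?Xu, ?Xt, q)"
    using opt by (fastforce simp: is_arg_min_def objective_def)
  then show ?thesis
    using u(4) t(4) by (simp add: U F flip: n_def)
qed

end
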